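(* For $n\ge1$ and $a,b\in\mathbb{N}\cup\{0\}$, \[ \sum_{k=0}^{bn}\binom{bn}{k}E_{n-1}^{(bn)}(x+k)=2^{bn}(n-1)!\sum_{l=0}^{n-1}\frac{(an)!}{(l+an)!\,(n-1-l)!}S_2(l+an,an)\,B_{n-1-l}^{(an)}(x). \]
   Context: For real $r$, the Bernoulli polynomials of order $r$ are defined by $\left(\frac{t}{e^t-1}\right)^re^{xt}=\sum_{n\ge0}B_n^{(r)}(x)\frac{t^n}{n!}$, and the Euler polynomials of order $r$ by $\left(\frac{2}{e^t+1}\right)^re^{xt}=\sum_{n\ge0}E_n^{(r)}(x)\frac{t^n}{n!}$. $S_2(n,k)$ denotes the Stirling numbers of the second kind. *)

theory Defs
  imports
    Complex_Main
    "HOL-Computational_Algebra.Formal_Power_Series"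
    "HOL-Combinatorics.Stirling"
begin

unbundle fps_syntax

text \<open>
  Real power of a formal power series with constant coefficient 1, given by Newton's binomial
  series \<open>f\<^sup>r = (\<Sum>k. (r gchoose k) * (f - 1)\<^sup>k)\<close>. It is meaningful only if \<open>f $ 0 = 1\<close>, since
  otherwise the composition is not a proper one.
\<close>
definition fps_rpow :: "'a::real_field fps \<Rightarrow> real \<Rightarrow> 'a fps" where
  "fps_rpow f r = fps_binomial (of_real r) oo (f - 1)"

lemma fps_rpow_of_nat:
  assumes "f $ 0 = 1"
  shows "fps_rpow f (real n) = f ^ n"
proof -
  have "fps_rpow f (real n) = (1 + fps_X) ^ n oo (f - 1)"
    by (simp add: fps_rpow_def fps_binomial_of_nat)
  also have "\<dots> = ((1 + fps_X) oo (f - 1)) ^ n"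
    using assms by (simp add: fps_compose_power)
  also have "(1 + fps_X) oo (f - 1) = f"
    using assms by (simp add: fps_compose_add_distrib)
  finally show ?thesis .
qed

lemma fps_rpow_add:
  assumes "f $ 0 = 1"
  shows "fps_rpow f (r + s) = fps_rpow f r * fps_rpow f s"
  using assms by (simp add: fps_rpow_def fps_binomial_add_mult fps_compose_mult_distrib)

definition bernoulli_gf :: "'a::real_field fps" where
  "bernoulli_gf = fps_X / (fps_exp 1 - 1)"

definition euler_gf :: "'a::real_field fps" where
  "euler_gf = 2 / (fps_exp 1 + 1)"

lemma bernoulli_gf_mult: "bernoulli_gf * (fps_exp 1 - 1) = (fps_X :: 'a::real_field fps)"
proof -
  have *: "fps_exp 1 - 1 \<noteq> (0 :: 'a fps)" "(fps_exp 1 - 1 :: 'a fps) $ 0 = 0"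
    "(fps_exp 1 - 1 :: 'a fps) $ 1 = 1"
    by (auto simp: fps_eq_iff intro!: exI[of _ 1])
  have "subdegree (fps_exp 1 - 1 :: 'a fps) = 1"
    by (rule subdegreeI) (use * in auto)
  with * have "(fps_exp 1 - 1 :: 'a fps) dvd fps_X"
    by (simp add: fps_dvd_iff)
  then show ?thesis
    by (simp add: bernoulli_gf_def)
qed

lemma bernoulli_gf_nth_0: "(bernoulli_gf :: 'a::real_field fps) $ 0 = 1"
proof -
  have "(bernoulli_gf * (fps_exp 1 - 1) :: 'a fps) $ 1 = 1"
    by (simp add: bernoulli_gf_mult)
  then show ?thesis
    by (simp add: fps_mult_nth)
qed

lemma euler_gf_nth_0: "(euler_gf :: 'a::real_field fps) $ 0 = 1"
  by (simp add: euler_gf_def fps_divide_unit fps_numeral_nth)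

text \<open>
  Bernoulli and Euler polynomials of real order \<open>r\<close>, evaluated at \<open>x\<close>: the coefficients of
  \<open>t\<^sup>n / n!\<close> in \<open>(t / (e\<^sup>t - 1))\<^sup>r e\<^sup>x\<^sup>t\<close> and \<open>(2 / (e\<^sup>t + 1))\<^sup>r e\<^sup>x\<^sup>t\<close>.
\<close>
definition bernoulli_poly :: "real \<Rightarrow> nat \<Rightarrow> 'a::real_field \<Rightarrow> 'a" where
  "bernoulli_poly r n x = fact n * (fps_rpow bernoulli_gf r * fps_exp x) $ n"

definition euler_poly :: "real \<Rightarrow> nat \<Rightarrow> 'a::real_field \<Rightarrow> 'a" where
  "euler_poly r n x = fact n * (fps_rpow euler_gf r * fps_exp x) $ n"

end

theory Submission
  imports Defs
begin

text \<open>
  Both sides are \<open>2\<^bsup>bn\<^esup> x\<^bsup>n-1\<^esup>\<close>. On the left, \<open>(e\<^sup>t + 1)\<^bsup>bn\<^esup>\<close>, expanded binomially, cancels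
  \<open>(2 / (e\<^sup>t + 1))\<^bsup>bn\<^esup>\<close> up to the factor \<open>2\<^bsup>bn\<^esup>\<close>. On the right, the Stirling numbers are the coefficients
  of \<open>((e\<^sup>t - 1) / t)\<^bsup>an\<^esup>\<close>, which cancels \<open>(t / (e\<^sup>t - 1))\<^bsup>an\<^esup>\<close>.
\<close>

text \<open>Since e^t = (e^t - 1) + 1, differentiating the k-th power of e^t - 1 gives k times the
  sum of its k-th and (k-1)-st powers. Read on coefficients, this is the Stirling
  recurrence.\<close>

lemma fps_exp_minus_1_power_nth:
  "((fps_exp 1 - 1) ^ k :: 'a::field_char_0 fps) $ m = fact k * of_nat (Stirling m k) / fact m"
proof (induction m arbitrary: k)
  case 0
  show ?case
    by (cases k) (simp_all add: fps_power_zeroth)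
next
  case (Suc m)
  show ?case
  proof (cases k)
    case 0
    then show ?thesis by simp
  next
    case k: (Suc j)
    let ?f = "fps_exp 1 - 1 :: 'a fps"
    have "fps_deriv (?f ^ k) = of_nat k * (?f ^ k + ?f ^ j)"
      by (subst fps_deriv_power') (simp add: k algebra_simps)
    then have "fps_deriv (?f ^ k) $ m = (of_nat k * (?f ^ k + ?f ^ j)) $ m"
      by simp
    then have "of_nat (Suc m) * (?f ^ k $ Suc m) = of_nat k * (?f ^ k $ m + ?f ^ j $ m)"
      by (simp only: fps_deriv_nth fps_mult_of_nat_nth fps_add_nth Suc_eq_plus1)
    \<comment> \<open>As k! = k * j!, the factor k! comes out and leaves k S(m,k) + S(m,j).\<close>
    also have "\<dots> = fact k * of_nat (Stirling (Suc m) k) / fact m"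
      unfolding Suc.IH by (simp add: k field_simps)
    finally show ?thesis
      by (simp add: field_simps del: of_nat_Suc)
  qed
qed

lemma euler_gf_mult: "euler_gf * (fps_exp 1 + 1) = (2 :: 'a::real_field fps)"
proof -
  have "is_unit (fps_exp 1 + 1 :: 'a fps)"
    by simp
  then show ?thesis
    unfolding euler_gf_def by (metis unit_imp_dvd dvd_div_mult_self)
qed

lemma sum_binomial_euler_poly:
  fixes x :: "'a::real_field"
  shows "(\<Sum>k\<le>N. of_nat (N choose k) * euler_poly (real N) m (x + of_nat k)) = 2 ^ N * x ^ m"
proof -
  have "(\<Sum>k\<le>N. of_nat (N choose k) * euler_poly (real N) m (x + of_nat k))
      = fact m * (\<Sum>k\<le>N. of_nat (N choose k) * (euler_gf ^ N * fps_exp (x + of_nat k))) $ m"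
    by (simp add: euler_poly_def fps_rpow_of_nat euler_gf_nth_0 fps_sum_nth fps_mult_of_nat_nth
        sum_distrib_left mult.left_commute[where b = "fact m"])
  \<comment> \<open>The shift by k contributes (e^t)^k, so the binomial theorem applies.\<close>
  also have "(\<Sum>k\<le>N. of_nat (N choose k) * (euler_gf ^ N * fps_exp (x + of_nat k)))
      = euler_gf ^ N * fps_exp x * (fps_exp 1 + 1) ^ N"
    by (simp add: fps_exp_add_mult fps_exp_power_mult binomial_ring sum_distrib_left mult_ac)
  also have "\<dots> = (euler_gf * (fps_exp 1 + 1)) ^ N * fps_exp x"
    by (simp add: power_mult_distrib mult_ac)
  also have "\<dots> = fps_const (2 ^ N) * fps_exp x"
    by (simp add: euler_gf_mult numeral_fps_const fps_const_power)
  finally show ?thesis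
    by simp
qed

lemma sum_Stirling_bernoulli_poly:
  fixes x :: "'a::real_field"
  shows "(\<Sum>l\<le>m. fact M / (fact (l + M) * fact (m - l)) * of_nat (Stirling (l + M) M)
            * bernoulli_poly (real M) (m - l) x) = x ^ m / fact m"
proof -
  \<comment> \<open>\<open>G\<close> is ((e^t - 1)/t)^M.\<close>
  define G :: "'a fps" where "G = fps_shift M ((fps_exp 1 - 1) ^ M)"
  \<comment> \<open>The shift drops only zeros: \<open>Stirling i M\<close> vanishes for i <
    M.\<close>
  have "fps_X ^ M * G = (fps_exp 1 - 1) ^ M"
    by (rule fps_ext) (simp add: G_def fps_X_power_mult_nth fps_exp_minus_1_power_nth)
  then have "fps_X ^ M * (G * bernoulli_gf ^ M) = ((fps_exp 1 - 1) * bernoulli_gf) ^ M"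
    by (simp add: power_mult_distrib flip: mult.assoc)
  also have "\<dots> = fps_X ^ M"
    by (simp add: mult.commute bernoulli_gf_mult)
  finally have "G * bernoulli_gf ^ M = 1"
    by simp
  then have "x ^ m / fact m = (G * (bernoulli_gf ^ M * fps_exp x)) $ m"
    by (simp flip: mult.assoc)
  \<comment> \<open>Coefficient l of \<open>G\<close> is coefficient l + M before the shift;
    dividing by (m - l)! undoes the factorial in \<open>bernoulli_poly\<close>.\<close>
  also have "\<dots> = (\<Sum>l\<le>m. fact M / (fact (l + M) * fact (m - l)) * of_nat (Stirling (l + M) M)
            * bernoulli_poly (real M) (m - l) x)"
    unfolding fps_mult_nth[of G] atMost_atLeast0
    by (simp add: G_def fps_exp_minus_1_power_nth
        bernoulli_poly_def fps_rpow_of_nat bernoulli_gf_nth_0 mult.assoc)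
  finally show ?thesis ..
qed

theorem theorem7:
  fixes n a b :: nat and x :: "'a::real_field"
  assumes "n \<ge> 1"
  shows "(\<Sum>k=0..b * n. of_nat ((b * n) choose k) * euler_poly (real (b * n)) (n - 1) (x + of_nat k))
       = 2 ^ (b * n) * fact (n - 1) *
         (\<Sum>l=0..n - 1. fact (a * n) / (fact (l + a * n) * fact (n - 1 - l))
            * of_nat (Stirling (l + a * n) (a * n))
            * bernoulli_poly (real (a * n)) (n - 1 - l) x)"
  unfolding atMost_atLeast0[symmetric] sum_binomial_euler_poly sum_Stirling_bernoulli_poly
  by simp

end
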